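(* Let $G$ be a group of order $t$ and let $k,\ell$ be positive integers. If $G$ has a Roman-$k$ $\ell$-tuple, then there exists an $\ell t \times t$ Roman-$k$ design.
   Context: For a finite group $G$ of order $t$ and an arrangement $\mathbf{a} = (a_1, \ldots, a_t)$ of the elements of $G$ (each element appearing exactly once), the quotient triangle of $\mathbf{a}$ consists of the lines $T_1, \ldots, T_{t-1}$, where line $T_j$ is the sequence $(a_1^{-1}a_{1+j}, a_2^{-1}a_{2+j}, \ldots, a_{t-j}^{-1}a_t)$. Let $\mathbf{A} = (\mathbf{a}_1, \ldots, \mathbf{a}_\ell)$ be an $\ell$-tuple of arrangements of the elements of $G$, let $T_{i,1}, \ldots, T_{i,t-1}$ be the lines of the quotient triangle of $\mathbf{a}_i$, and for each $j$ let $U_j$ be the concatenation of $T_{1,j}, T_{2,j}, \ldots, T_{\ell,j}$. Then $\mathbf{A}$ is a Roman-$k$ $\ell$-tuple if every non-identity element of $G$ appears at most $\ell$ times in $U_j$ for each $1 \le j \le k$. A crossover design with $n$ subjects and $t$ treatments and periods is an $n \times t$ array $D$ of treatments ($D_{ij}$ = treatment given to subject $i$ in period $j$), assumed uniform: each treatment occurs exactly once in each row and exactly $n/t$ times in each column. For distinct treatments $x,y$ and $1\le d\le t-1$, $o_d(x,y)$ is the number of times, over all rows, that $y$ occurs exactly $d$ periods after $x$ in the same row. The design is Roman-$k$ if $o_d(x,y) \le n/t$ for all ordered pairs of distinct treatments and all $1 \le d \le k$. An "$\ell t \times t$ design" has $\ell t$ rows. *)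

theory Defs
  imports Complex_Main "HOL-Algebra.Coset"
begin

(* Sequences and arrays are indexed from 0: entry a_i of the mathematical text is a ! (i - 1). *)

definition arrangement :: "('a, 'b) monoid_scheme \<Rightarrow> 'a list \<Rightarrow> bool" where
  "arrangement G a \<longleftrightarrow> distinct a \<and> set a = carrier G"

definition quotient_line :: "('a, 'b) monoid_scheme \<Rightarrow> 'a list \<Rightarrow> nat \<Rightarrow> 'a list" where
  "quotient_line G a j =
     map (\<lambda>i. inv\<^bsub>G\<^esub> (a ! i) \<otimes>\<^bsub>G\<^esub> a ! (i + j)) [0..<length a - j]"

definition joined_line :: "('a, 'b) monoid_scheme \<Rightarrow> 'a list list \<Rightarrow> nat \<Rightarrow> 'a list" where
  "joined_line G A j = concat (map (\<lambda>a. quotient_line G a j) A)"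

(* Lines with j \<ge> order G are empty, so values k \<ge> order G impose nothing beyond
   k = order G - 1; the same holds for pair_count and roman_design below. *)
definition roman_tuple :: "('a, 'b) monoid_scheme \<Rightarrow> nat \<Rightarrow> nat \<Rightarrow> 'a list list \<Rightarrow> bool" where
  "roman_tuple G k l A \<longleftrightarrow>
     length A = l \<and> (\<forall>a \<in> set A. arrangement G a) \<and>
     (\<forall>j \<in> {1..k}. \<forall>g \<in> carrier G - {\<one>\<^bsub>G\<^esub>}. count_list (joined_line G A j) g \<le> l)"

(* V is the set of treatments, n the number of subjects, t the number of treatments and of
   periods; only the values D i j with i < n and j < t are meaningful. *)
definition crossover_design :: "'v set \<Rightarrow> nat \<Rightarrow> nat \<Rightarrow> (nat \<Rightarrow> nat \<Rightarrow> 'v) \<Rightarrow> bool" where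
  "crossover_design V n t D \<longleftrightarrow>
     finite V \<and> card V = t \<and>
     (\<forall>i < n. \<forall>j < t. D i j \<in> V) \<and>
     (\<forall>i < n. \<forall>x \<in> V. card {j. j < t \<and> D i j = x} = 1) \<and>
     (\<forall>j < t. \<forall>x \<in> V. real (card {i. i < n \<and> D i j = x}) = real n / real t)"

definition pair_count :: "nat \<Rightarrow> nat \<Rightarrow> (nat \<Rightarrow> nat \<Rightarrow> 'v) \<Rightarrow> nat \<Rightarrow> 'v \<Rightarrow> 'v \<Rightarrow> nat" where
  "pair_count n t D d x y =
     card {(i, j). i < n \<and> j + d < t \<and> D i j = x \<and> D i (j + d) = y}"

definition roman_design :: "nat \<Rightarrow> 'v set \<Rightarrow> nat \<Rightarrow> nat \<Rightarrow> (nat \<Rightarrow> nat \<Rightarrow> 'v) \<Rightarrow> bool" where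
  "roman_design k V n t D \<longleftrightarrow>
     crossover_design V n t D \<and>
     (\<forall>d \<in> {1..k}. \<forall>x \<in> V. \<forall>y \<in> V. x \<noteq> y \<longrightarrow> real (pair_count n t D d x y) \<le> real n / real t)"

end

theory Submission
  imports Defs
begin

text \<open>
  Develop each arrangement of the tuple by left translation: the rows of the design are the
  sequences \<open>g a\<^sub>1, \<dots>, g a\<^sub>t\<close>, for \<open>g\<close> in \<open>G\<close> and \<open>a\<close> in the tuple. Left translation preserves the
  quotients of entries, and an entry \<open>x\<close> of a row determines \<open>g\<close> once the arrangement and the
  position are known; so the occurrences of \<open>(x, y)\<close> at distance \<open>d\<close> inject into the
  occurrences of \<open>x\<^sup>-\<^sup>1 y\<close> in the \<open>d\<close>-th joined line.
\<close>

lemma count_list_map_upt: "count_list (map f [0..<n]) g = card {i. i < n \<and> f i = g}"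
proof -
  have "count_list (map f [0..<n]) g = length (filter (\<lambda>i. f i = g) [0..<n])"
    by (induction n) auto
  also have "\<dots> = card (set (filter (\<lambda>i. f i = g) [0..<n]))"
    by (rule distinct_card[symmetric]) simp
  finally show ?thesis
    by (simp add: conj_commute)
qed

lemma count_list_concat: "count_list (concat xss) x = (\<Sum>c<length xss. count_list (xss ! c) x)"
  by (induction xss) (simp_all add: sum.lessThan_Suc_shift del: sum.lessThan_Suc)

text \<open>Recasts the count as the cardinality of a set of pairs (arrangement, position), the
  shape used in \<open>pair_count\<close>, so that an injection can compare the two.\<close>

lemma count_list_joined_line:
  assumes "\<And>a. a \<in> set A \<Longrightarrow> length a = t"
  shows "count_list (joined_line G A d) g =
    card {(c, j). c < length A \<and> j + d < t \<and> inv\<^bsub>G\<^esub> (A ! c ! j) \<otimes>\<^bsub>G\<^esub> A ! c ! (j + d) = g}"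
    (is "_ = card ?S")
proof -
  have "count_list (joined_line G A d) g =
      (\<Sum>c<length A. card {j. j < t - d \<and> inv\<^bsub>G\<^esub> (A ! c ! j) \<otimes>\<^bsub>G\<^esub> A ! c ! (j + d) = g})"
    unfolding joined_line_def count_list_concat quotient_line_def
    by (simp add: count_list_map_upt assms)
  also have "\<dots> = card (SIGMA c:{..<length A}.
      {j. j < t - d \<and> inv\<^bsub>G\<^esub> (A ! c ! j) \<otimes>\<^bsub>G\<^esub> A ! c ! (j + d) = g})"
    by simp
  \<comment> \<open>Subtraction on \<open>nat\<close> is truncated, so \<open>j < t - d\<close> and
    \<open>j + d < t\<close> agree also when \<open>d\<close> is at least \<open>t\<close>: both are
    then false.\<close>
  also have "(SIGMA c:{..<length A}.
      {j. j < t - d \<and> inv\<^bsub>G\<^esub> (A ! c ! j) \<otimes>\<^bsub>G\<^esub> A ! c ! (j + d) = g}) = ?S"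
    by auto
  finally show ?thesis .
qed

lemma length_arrangement: "arrangement G a \<Longrightarrow> length a = order G"
  by (metis arrangement_def distinct_card order_def)

lemma arrangement_nth_closed: "arrangement G a \<Longrightarrow> i < order G \<Longrightarrow> a ! i \<in> carrier G"
  by (metis arrangement_def length_arrangement nth_mem)

lemma arrangement_nth_eq_iff:
  "arrangement G a \<Longrightarrow> i < order G \<Longrightarrow> j < order G \<Longrightarrow> a ! i = a ! j \<longleftrightarrow> i = j"
  by (metis arrangement_def length_arrangement nth_eq_iff_index_eq)

lemma arrangement_obtain_index:
  assumes "arrangement G a" "x \<in> carrier G"
  obtains i where "i < order G" "a ! i = x"
  using assms by (metis arrangement_def in_set_conv_nth length_arrangement)

context group
begin

lemma inv_mult_left_translate:
  assumes "g \<in> carrier G" "x \<in> carrier G" "y \<in> carrier G"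
  shows "inv (g \<otimes> x) \<otimes> (g \<otimes> y) = inv x \<otimes> y"
proof -
  have "inv g \<otimes> (g \<otimes> y) = y"
    using assms by (simp flip: m_assoc)
  then show ?thesis
    using assms by (simp add: inv_mult_group m_assoc)
qed

text \<open>A row number encodes a pair: its quotient by \<open>order G\<close> selects the
  arrangement, its remainder the translating element. The list \<open>b\<close> is meant to
  enumerate the group; its order affects only the order of the rows within a block.\<close>

definition developed_design :: "'a list \<Rightarrow> 'a list list \<Rightarrow> nat \<Rightarrow> nat \<Rightarrow> 'a" where
  "developed_design b A i j = b ! (i mod order G) \<otimes> A ! (i div order G) ! j"

context
  fixes b :: "'a list" and A :: "'a list list"
  assumes fin: "finite (carrier G)"
    and b: "arrangement G b"
    and A: "\<forall>a \<in> set A. arrangement G a"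
begin

lemma order_pos: "order G > 0"
  using fin order_gt_0_iff_finite by blast

lemma block_arrangement: "i < length A * order G \<Longrightarrow> arrangement G (A ! (i div order G))"
  by (simp add: A less_mult_imp_div_less)

lemma row_translate_closed: "b ! (i mod order G) \<in> carrier G"
  by (simp add: arrangement_nth_closed[OF b] order_pos)

text \<open>Within a block, column \<open>j\<close> holds the translates of one fixed element, so
  right cancellation recovers the translating element and with it the remainder of the row number.
  Both the column count and the pair count draw their injectivity from this.\<close>

lemma developed_design_row_unique:
  assumes "i < length A * order G" "j < order G" "i' < length A * order G"
    and "i div order G = i' div order G"
    and "developed_design b A i j = developed_design b A i' j"
  shows "i = i'"
proof -
  have "A ! (i div order G) ! j \<in> carrier G"
    using assms block_arrangement arrangement_nth_closed by blast
  then have "b ! (i mod order G) = b ! (i' mod order G)"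
    using assms(4,5) row_translate_closed by (simp add: developed_design_def)
  then have "i mod order G = i' mod order G"
    using arrangement_nth_eq_iff[OF b] order_pos by simp
  then show ?thesis
    using assms(4) by (metis div_mult_mod_eq)
qed

text \<open>Left translation by \<open>?g\<close> permutes the group, so \<open>x\<close> stands
  exactly where the arrangement has \<open>inv ?g \<otimes> x\<close>.\<close>

lemma developed_design_row_count:
  assumes i: "i < length A * order G" and x: "x \<in> carrier G"
  shows "card {j. j < order G \<and> developed_design b A i j = x} = 1"
proof -
  let ?a = "A ! (i div order G)" and ?g = "b ! (i mod order G)"
  have a: "arrangement G ?a"
    using block_arrangement[OF i] .
  obtain j where j: "j < order G" "?a ! j = inv ?g \<otimes> x"
    using arrangement_obtain_index[OF a, of "inv ?g \<otimes> x"] row_translate_closed x by blast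
  have "developed_design b A i j' = x \<longleftrightarrow> j' = j" if "j' < order G" for j'
  proof -
    have "developed_design b A i j' = x \<longleftrightarrow> ?a ! j' = inv ?g \<otimes> x"
      using arrangement_nth_closed[OF a that] row_translate_closed[of i] x
      by (metis developed_design_def inv_solve_left)
    then show ?thesis
      using j arrangement_nth_eq_iff[OF a that j(1)] by simp
  qed
  then have "{j. j < order G \<and> developed_design b A i j = x} = {j}"
    using j by auto
  then show ?thesis by simp
qed

text \<open>Each block contributes exactly one row: sending rows to blocks is injective on
  \<open>?S\<close>, and it reaches every block because a suitable translating element always
  exists.\<close>

lemma developed_design_column_count:
  assumes j: "j < order G" and x: "x \<in> carrier G"
  shows "card {i. i < length A * order G \<and> developed_design b A i j = x} = length A"
    (is "card ?S = _")
proof -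
  have "inj_on (\<lambda>i. i div order G) ?S"
    using j developed_design_row_unique by (auto intro!: inj_onI)
  moreover have "(\<lambda>i. i div order G) ` ?S = {..<length A}"
  proof (intro equalityI subsetI)
    fix c assume "c \<in> (\<lambda>i. i div order G) ` ?S"
    then show "c \<in> {..<length A}"
      by (auto simp: less_mult_imp_div_less)
  next
    fix c assume c: "c \<in> {..<length A}"
    then have h: "A ! c ! j \<in> carrier G"
      using A arrangement_nth_closed j by (metis lessThan_iff nth_mem)
    \<comment> \<open>The element that carries entry \<open>j\<close> of arrangement
      \<open>c\<close> to \<open>x\<close>, located in \<open>b\<close>.\<close>
    obtain r where r: "r < order G" "b ! r = x \<otimes> inv (A ! c ! j)"
      using arrangement_obtain_index[OF b, of "x \<otimes> inv (A ! c ! j)"] h x by blast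
    let ?i = "c * order G + r"
    have "?i < Suc c * order G"
      using r by simp
    also have "\<dots> \<le> length A * order G"
      using c by (intro mult_le_mono1) auto
    finally have "?i < length A * order G" .
    moreover have "?i div order G = c" "?i mod order G = r"
      using r by auto
    moreover have "developed_design b A ?i j = x"
      using r h x by (simp add: developed_design_def m_assoc)
    ultimately show "c \<in> (\<lambda>i. i div order G) ` ?S"
      by (intro image_eqI[of _ _ ?i]) auto
  qed
  ultimately show ?thesis
    using card_image by fastforce
qed

lemma developed_design_pair_count_le:
  "pair_count (length A * order G) (order G) (developed_design b A) d x y
    \<le> count_list (joined_line G A d) (inv x \<otimes> y)"
proof -
  let ?n = "length A * order G" and ?D = "developed_design b A"
  let ?P = "{(i, j). i < ?n \<and> j + d < order G \<and> ?D i j = x \<and> ?D i (j + d) = y}"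
  let ?S = "{(c, j). c < length A \<and> j + d < order G \<and>
    inv (A ! c ! j) \<otimes> A ! c ! (j + d) = inv x \<otimes> y}"
  let ?f = "\<lambda>(i, j). (i div order G, j :: nat)"
  \<comment> \<open>Occurrences with the same image share block and column, and both rows have
    \<open>x\<close> there.\<close>
  have "inj_on ?f ?P"
    by (rule inj_onI) (auto intro: developed_design_row_unique)
  moreover have "?f ` ?P \<subseteq> ?S"
  \<comment> \<open>Here \<open>x\<close> and \<open>y\<close> are replaced by the two entries of
    the row, from whose quotient the translating element cancels.\<close>
  proof clarify
    fix i j
    assume i: "i < ?n" and j: "j + d < order G"
    let ?a = "A ! (i div order G)"
    have "?a ! j \<in> carrier G" "?a ! (j + d) \<in> carrier G"
      using arrangement_nth_closed[OF block_arrangement[OF i]] j by auto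
    then have "inv (?a ! j) \<otimes> ?a ! (j + d) = inv (?D i j) \<otimes> ?D i (j + d)"
      by (simp add: developed_design_def inv_mult_left_translate row_translate_closed)
    then show "i div order G < length A \<and> j + d < order G \<and>
        inv (?a ! j) \<otimes> ?a ! (j + d) = inv (?D i j) \<otimes> ?D i (j + d)"
      using i j by (simp add: less_mult_imp_div_less)
  qed
  moreover have "finite ?S"
    by (rule finite_subset[of _ "{..<length A} \<times> {..<order G}"]) auto
  ultimately have "card ?P \<le> card ?S"
    by (rule card_inj_on_le)
  also have "card ?S = count_list (joined_line G A d) (inv x \<otimes> y)"
    by (rule count_list_joined_line[symmetric]) (simp add: A length_arrangement)
  finally show ?thesis
    unfolding pair_count_def .
qed

lemma crossover_design_developed_design:
  "crossover_design (carrier G) (length A * order G) (order G) (developed_design b A)"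
  unfolding crossover_design_def
proof (intro conjI allI impI ballI)
  show "developed_design b A i j \<in> carrier G"
    if "i < length A * order G" "j < order G" for i j
    using that row_translate_closed arrangement_nth_closed[OF block_arrangement]
    by (simp add: developed_design_def)
next
  show "real (card {i. i < length A * order G \<and> developed_design b A i j = x}) =
      real (length A * order G) / real (order G)"
    if "j < order G" "x \<in> carrier G" for j x
    using developed_design_column_count[OF that] order_pos by simp
\<comment> \<open>What remains is finiteness, the number of treatments and the row
  condition.\<close>
qed (simp_all add: fin developed_design_row_count flip: order_def)

end

end

theorem theorem5:
  fixes G :: "('a, 'b) monoid_scheme" and t k l :: nat
  assumes "group G" and "finite (carrier G)" and "order G = t"
    and "k \<ge> 1" and "l \<ge> 1"
    and "\<exists>A. roman_tuple G k l A"
  shows "\<exists>(V :: 'a set) D. roman_design k V (l * t) t D"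
proof -
  interpret group G by fact
  obtain A where A: "length A = l" "\<forall>a \<in> set A. arrangement G a"
    and count: "\<And>j g. j \<in> {1..k} \<Longrightarrow> g \<in> carrier G - {\<one>\<^bsub>G\<^esub>} \<Longrightarrow>
      count_list (joined_line G A j) g \<le> l"
    using assms(6) unfolding roman_tuple_def by blast
  obtain b where b: "arrangement G b"
    unfolding arrangement_def using finite_distinct_list[OF assms(2)] by blast
  have "real (pair_count (l * t) t (developed_design b A) d x y) \<le> real (l * t) / real t"
    if "d \<in> {1..k}" "x \<in> carrier G" "y \<in> carrier G" "x \<noteq> y" for d x y
  proof -
    \<comment> \<open>Otherwise \<open>x\<close> and \<open>y\<close> would have the same inverse.
      The Roman bound covers only non-identity elements.\<close>
    have "inv\<^bsub>G\<^esub> x \<otimes>\<^bsub>G\<^esub> y \<noteq> \<one>\<^bsub>G\<^esub>"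
      using that by (metis inv_equality inv_inv inv_closed)
    then have "count_list (joined_line G A d) (inv\<^bsub>G\<^esub> x \<otimes>\<^bsub>G\<^esub> y) \<le> l"
      using that by (intro count) auto
    then have "pair_count (l * t) t (developed_design b A) d x y \<le> l"
      using developed_design_pair_count_le[OF assms(2) b A(2), of d x y] A(1) assms(3) by simp
    then show ?thesis
      using order_pos[OF assms(2) b A(2)] assms(3) by simp
  qed
  then have "roman_design k (carrier G) (l * t) t (developed_design b A)"
    using crossover_design_developed_design[OF assms(2) b A(2)] A(1) assms(3)
    unfolding roman_design_def by simp
  then show ?thesis by blast
qed

end
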